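(* Let $p,q$ be squarefree positive integers such that $K=\mathbb{Q}(\sqrt p,\sqrt q)$ is a biquadratic number field, and let $r=\frac{pq}{\gcd(p,q)^2}$. Assume that $\alpha\in\mathcal{O}_K^+$ satisfies $\mathcal{N}(\alpha)<2\min(\sqrt p,\sqrt q,\sqrt r)$ and that $n\nmid\alpha$ (in $\mathcal{O}_K$) for any $n\in\mathbb{N}$, $n>1$. Then $\alpha$ is indecomposable.
   Context: $\mathcal{O}_K$ is the ring of integers of $K$, and $\mathcal{O}_K^+$ is the set of totally positive integers, i.e. elements $\alpha\in\mathcal{O}_K$ with $\sigma(\alpha)>0$ for every embedding $\sigma:K\to\mathbb{C}$. $\mathcal{N}(\alpha)=\prod_\sigma\sigma(\alpha)$ is the norm from $K$ to $\mathbb{Q}$. An element $\alpha\in\mathcal{O}_K^+$ is indecomposable if it cannot be written as $\alpha=\beta+\gamma$ with $\beta,\gamma\in\mathcal{O}_K^+$. A biquadratic field $\mathbb{Q}(\sqrt p,\sqrt q)$ has degree 4 over $\mathbb{Q}$. *)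

theory Defs
  imports
    "HOL-Computational_Algebra.Computational_Algebra"
    "HOL-Algebra.Algebra"
    "HOL-Algebra.Algebraic_Closure_Type"
    "HOL-Library.Complex_Order"
begin

text \<open>
  Number fields are represented as subfields of the field of complex numbers. The order on
  complex numbers is the one of \<^theory>\<open>HOL-Library.Complex_Order\<close>: \<open>x < y\<close> means
  \<open>Re x < Re y\<close> and \<open>Im x = Im y\<close>, so \<open>0 < x\<close> says that \<open>x\<close> is real and positive.
\<close>

abbreviation complex_ring :: "complex ring" where
  "complex_ring \<equiv> ring_of_type_algebra"

abbreviation subring_of_complex :: "complex set \<Rightarrow> complex ring" where
  "subring_of_complex A \<equiv> complex_ring \<lparr>carrier := A\<rparr>"

definition Q_adjoin_sqrts :: "nat \<Rightarrow> nat \<Rightarrow> complex set" where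
  "Q_adjoin_sqrts p q =
     generate_field complex_ring {complex_of_real (sqrt (real p)), complex_of_real (sqrt (real q))}"

definition ring_of_integers :: "complex set \<Rightarrow> complex set" where
  "ring_of_integers K = {x \<in> K. algebraic_int x}"

text \<open>
  Being extensional (i.e. \<open>undefined\<close> outside \<open>K\<close>) makes distinct elements of this set distinct as
  maps on \<open>K\<close>, so that each embedding contributes exactly one factor to the norm.
\<close>

definition embeddings :: "complex set \<Rightarrow> (complex \<Rightarrow> complex) set" where
  "embeddings K = ring_hom (subring_of_complex K) complex_ring \<inter> extensional K"

definition totally_positive_integers :: "complex set \<Rightarrow> complex set" where
  "totally_positive_integers K = {x \<in> ring_of_integers K. \<forall>\<sigma>\<in>embeddings K. 0 < \<sigma> x}"

definition field_norm :: "complex set \<Rightarrow> complex \<Rightarrow> complex" where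
  "field_norm K x = (\<Prod>\<sigma>\<in>embeddings K. \<sigma> x)"

definition indecomposable :: "complex set \<Rightarrow> complex \<Rightarrow> bool" where
  "indecomposable K x \<longleftrightarrow>
     x \<in> totally_positive_integers K \<and>
     \<not> (\<exists>y\<in>totally_positive_integers K. \<exists>z\<in>totally_positive_integers K. x = y + z)"

end

theory Submission
  imports Defs "Jordan_Normal_Form.Char_Poly"
begin

text \<open>
  Suppose \<open>\<alpha> = \<beta> + \<gamma>\<close> with \<open>\<beta>\<close>, \<open>\<gamma>\<close> totally positive, and let \<open>L\<close> be one of the
  quadratic subfields \<open>\<rat>(\<surd>d)\<close>, \<open>d \<in> {p, q, r}\<close>. The product of \<open>N\<^bsub>K/L\<^esub>(\<beta>)\<close> with the
  conjugate of \<open>N\<^bsub>K/L\<^esub>(\<gamma>)\<close> is a totally positive integer of \<open>L\<close>, so its trace exceeds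
  \<open>\<surd>d\<close> unless it is rational. The three traces are sums of distinct terms in the expansion
  of \<open>\<N>(\<alpha>) = \<Prod>\<^sub>i (\<beta>\<^sub>i + \<gamma>\<^sub>i)\<close>, so at most one of the three products is irrational.
  If two of them are rational, then \<open>\<beta>/\<gamma>\<close> lies in the third subfield \<open>L\<close>, and hence so does
  the integer \<open>\<epsilon> = \<beta>\<N>(\<gamma>)/\<gamma>\<close>. The four conjugates of \<open>\<epsilon>\<close> also occur in the expansion and
  add up to twice its trace over \<open>L\<close>, so \<open>\<epsilon>\<close> is rational. Then \<open>\<beta>\<close> and \<open>\<gamma>\<close> are positive
  rational multiples of \<open>\<alpha>\<close>, which makes \<open>\<alpha>\<close> divisible by an integer greater than 1.
\<close>

section \<open>Algebraic integers\<close>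

text \<open>The \<open>v i\<close>, not all zero, form an eigenvector of the integer matrix
  \<open>A\<close> for \<open>x\<close>, so \<open>x\<close> is a root of its characteristic
  polynomial, which is monic with integer coefficients.\<close>

lemma algebraic_int_if_eigen:
  fixes x :: "'a :: field_char_0" and A :: "nat \<Rightarrow> nat \<Rightarrow> int"
  assumes eig: "\<And>i. i < n \<Longrightarrow> x * v i = (\<Sum>j<n. of_int (A i j) * v j)"
    and "k < n" "v k \<noteq> 0"
  shows "algebraic_int x"
proof -
  define B where "B = mat n n (\<lambda>(i, j). A i j)"
  define B' where "B' = map_mat (of_int :: int \<Rightarrow> 'a) B"
  have B: "B \<in> carrier_mat n n" and B': "B' \<in> carrier_mat n n"
    by (auto simp: B_def B'_def)
  have "eigenvalue B' x"
    unfolding eigenvalue_def eigenvector_def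
  proof (intro exI[of _ "vec n v"] conjI)
    show "vec n v \<noteq> 0\<^sub>v (dim_row B')"
      using assms(2,3) B' by (auto simp: vec_eq_iff)
    show "B' *\<^sub>v vec n v = x \<cdot>\<^sub>v vec n v"
      by (rule eq_vecI) (auto simp: B'_def B_def scalar_prod_def eig atLeast0LessThan)
  qed (use B' in auto)
  hence "poly (char_poly B') x = 0"
    using eigenvalue_root_char_poly[OF B'] by simp
  moreover have "char_poly B' = map_poly of_int (char_poly B)"
    unfolding B'_def by (rule of_int_hom.char_poly_hom[OF B])
  moreover have "lead_coeff (char_poly B) = 1"
    using degree_monic_char_poly[OF B] by simp
  ultimately show ?thesis
    by (auto simp: algebraic_int_altdef_ipoly)
qed

abbreviation int_span :: "'a :: field_char_0 set \<Rightarrow> 'a set" where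
  "int_span \<equiv> Modules.module.span (\<lambda>(k::int) x. of_int k * x)"

interpretation int_module: Modules.module "\<lambda>(k::int) (x::'a::field_char_0). of_int k * x"
  by unfold_locales (auto simp: algebra_simps)

text \<open>Multiplication by \<open>x\<close> acts on the generators of a finitely generated
  subgroup through an integer matrix. The list of generators is an eigenvector for it, nonzero
  because of \<open>s\<close>.\<close>

lemma algebraic_int_if_int_span:
  fixes x :: "'a :: field_char_0"
  assumes fin: "finite S" and "s \<in> S" "s \<noteq> 0"
    and stable: "\<And>s. s \<in> S \<Longrightarrow> x * s \<in> int_span S"
  shows "algebraic_int x"
proof -
  obtain f where f: "bij_betw f {..<card S} S"
    using fin by (metis atLeast0LessThan ex_bij_betw_nat_finite)
  have "\<exists>u. x * s = (\<Sum>t\<in>S. of_int (u t) * t)" if "s \<in> S" for s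
    using stable[OF that] int_module.span_finite[OF fin] by auto
  then obtain u where u: "\<And>s. s \<in> S \<Longrightarrow> x * s = (\<Sum>t\<in>S. of_int (u s t) * t)"
    by metis
  obtain k where k: "k < card S" "f k = s"
    using bij_betw_imp_surj_on[OF f] \<open>s \<in> S\<close> by (metis imageE lessThan_iff)
  show ?thesis
  proof (rule algebraic_int_if_eigen[of "card S" x f "\<lambda>i j. u (f i) (f j)" k])
    fix i assume "i < card S"
    hence "f i \<in> S" using f by (auto simp: bij_betw_def)
    from u[OF this] show "x * f i = (\<Sum>j<card S. of_int (u (f i) (f j)) * f j)"
      using sum.reindex_bij_betw[OF f, of "\<lambda>t. of_int (u (f i) t) * t"] by simp
  qed (use k \<open>s \<noteq> 0\<close> in auto)
qed

text \<open>Stability passes from generators to the whole span by linearity. This allows a product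
  to be applied to the span one factor at a time.\<close>

lemma int_span_mult_closed:
  fixes x :: "'a :: field_char_0"
  assumes "\<And>s. s \<in> S \<Longrightarrow> x * s \<in> int_span S" and "y \<in> int_span S"
  shows "x * y \<in> int_span S"
  using assms(2)
proof (induction rule: int_module.span_induct_alt)
  case base
  then show ?case by (simp add: int_module.span_zero)
next
  case (step c s y)
  have "x * (of_int c * s + y) = of_int c * (x * s) + x * y" by (simp add: algebra_simps)
  then show ?case
    using int_module.span_add[OF int_module.span_scale[OF assms(1)[OF step(1)]] step(2)] by simp
qed

text \<open>The span is Z[x, y]: monic equations of degrees \<open>m\<close> and \<open>n\<close>
  reduce every monomial to some \<open>x ^ i * y ^ j\<close> with \<open>i < m\<close> and
  \<open>j < n\<close>. One module stable under both elements serves for the sum and the product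
  alike.\<close>

lemma algebraic_int_common_span:
  fixes x y :: "'a :: field_char_0"
  assumes "algebraic_int x" "algebraic_int y"
  obtains S where "finite S" "1 \<in> S"
    "\<And>s. s \<in> S \<Longrightarrow> x * s \<in> int_span S" "\<And>s. s \<in> S \<Longrightarrow> y * s \<in> int_span S"
proof -
  \<comment> \<open>A monic equation solved for its leading power. Positivity of the degree is what
    later puts \<open>1 = x ^ 0 * y ^ 0\<close> into \<open>S\<close>.\<close>
  have ex: "\<exists>n c. n > 0 \<and> z ^ n = (\<Sum>k<n. of_int (c k) * z ^ k)" if z: "algebraic_int z" for z :: 'a
  proof -
    obtain p where p: "poly (map_poly of_int p) z = 0" "lead_coeff p = 1"
      using z by (auto simp: algebraic_int_altdef_ipoly)
    have deg: "degree p > 0"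
    proof (rule ccontr)
      assume "\<not> degree p > 0"
      with p(2) have "p = 1" by (auto elim!: degree_eq_zeroE)
      with p(1) show False by simp
    qed
    have "0 = (\<Sum>k\<le>degree p. of_int (coeff p k) * z ^ k)"
      using p(1) by (simp add: poly_altdef degree_map_poly coeff_map_poly)
    also have "\<dots> = (\<Sum>k<degree p. of_int (coeff p k) * z ^ k) + z ^ degree p"
      using p(2) by (simp flip: lessThan_Suc_atMost)
    finally have "z ^ degree p = - (\<Sum>k<degree p. of_int (coeff p k) * z ^ k)"
      by (simp add: eq_neg_iff_add_eq_0 add.commute)
    also have "\<dots> = (\<Sum>k<degree p. of_int (- coeff p k) * z ^ k)"
      by (simp add: sum_negf)
    finally show ?thesis
      using deg by (intro exI[of _ "degree p"] exI[of _ "\<lambda>k. - coeff p k"]) simp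
  qed
  obtain m c where m: "m > 0" "x ^ m = (\<Sum>k<m. of_int (c k) * x ^ k)" using ex[OF assms(1)] by blast
  obtain n d where n: "n > 0" "y ^ n = (\<Sum>k<n. of_int (d k) * y ^ k)" using ex[OF assms(2)] by blast
  define S where "S = (\<lambda>(i, j). x ^ i * y ^ j) ` ({..<m} \<times> {..<n})"
  have S: "x ^ i * y ^ j \<in> int_span S" if "i < m" "j < n" for i j
    using that by (intro int_module.span_base) (auto simp: S_def)
  show ?thesis
  proof (rule that[of S])
    show "finite S" by (auto simp: S_def)
    show "1 \<in> S" using m(1) n(1) by (force simp: S_def)
  next
    fix s assume "s \<in> S"
    then obtain i j where ij: "i < m" "j < n" "s = x ^ i * y ^ j" by (auto simp: S_def)
    show "x * s \<in> int_span S"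
    proof (cases "Suc i = m")
      case True
      have "x * s = x ^ m * y ^ j" using ij True by (auto simp: mult_ac)
      also have "\<dots> = (\<Sum>k<m. of_int (c k) * (x ^ k * y ^ j))"
        unfolding m(2) by (simp only: sum_distrib_right mult.assoc)
      finally show ?thesis
        using ij S by (auto intro!: int_module.span_sum int_module.span_scale)
    next
      case False
      with S[of "Suc i" j] ij show ?thesis by (simp add: mult_ac)
    qed
    show "y * s \<in> int_span S"
    proof (cases "Suc j = n")
      case True
      have "y * s = x ^ i * y ^ n" using ij True by (auto simp: mult_ac)
      also have "\<dots> = (\<Sum>k<n. of_int (d k) * (x ^ i * y ^ k))"
        unfolding n(2) by (simp only: sum_distrib_left mult.left_commute)
      finally show ?thesis
        using ij S by (auto intro!: int_module.span_sum int_module.span_scale)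
    next
      case False
      with S[of i "Suc j"] ij show ?thesis by (simp add: mult_ac)
    qed
  qed
qed

lemma algebraic_int_add [intro]:
  fixes x y :: "'a :: field_char_0"
  assumes "algebraic_int x" "algebraic_int y"
  shows "algebraic_int (x + y)"
proof -
  obtain S where "finite S" "1 \<in> S"
    and S: "\<And>s. s \<in> S \<Longrightarrow> x * s \<in> int_span S" "\<And>s. s \<in> S \<Longrightarrow> y * s \<in> int_span S"
    using algebraic_int_common_span[OF assms] by blast
  then show ?thesis
    by (intro algebraic_int_if_int_span[of S 1])
       (auto simp: distrib_right intro: int_module.span_add)
qed

lemma algebraic_int_mult [intro]:
  fixes x y :: "'a :: field_char_0"
  assumes "algebraic_int x" "algebraic_int y"
  shows "algebraic_int (x * y)"
proof -
  obtain S where "finite S" "1 \<in> S"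
    and S: "\<And>s. s \<in> S \<Longrightarrow> x * s \<in> int_span S" "\<And>s. s \<in> S \<Longrightarrow> y * s \<in> int_span S"
    using algebraic_int_common_span[OF assms] by blast
  then show ?thesis
    by (intro algebraic_int_if_int_span[of S 1])
       (auto simp: mult.assoc intro: int_span_mult_closed)
qed

section \<open>Biquadratic fields and their embeddings\<close>

lemmas field_complex_ring = field_from_type_algebra[where 'a = complex]

interpretation complex_ring: cring "complex_ring"
  by (rule cring_from_type_algebra)

lemma complex_ring_simps [simp]:
  "carrier complex_ring = UNIV" "\<one>\<^bsub>complex_ring\<^esub> = 1" "\<zero>\<^bsub>complex_ring\<^esub> = 0"
  "x \<oplus>\<^bsub>complex_ring\<^esub> y = x + y" "x \<otimes>\<^bsub>complex_ring\<^esub> y = x * y"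
  by (auto simp: ring_of_type_algebra_def)

lemma complex_ring_a_inv [simp]: "\<ominus>\<^bsub>complex_ring\<^esub> x = - x"
  by (rule complex_ring.minus_equality) auto

lemma complex_ring_m_inv: "x \<noteq> 0 \<Longrightarrow> inv\<^bsub>complex_ring\<^esub> x = inverse x"
  by (rule complex_ring.comm_inv_char) auto

lemma subfield_complexI:
  assumes "1 \<in> F" "\<And>x. x \<in> F \<Longrightarrow> - x \<in> F" "\<And>x. x \<in> F \<Longrightarrow> inverse x \<in> F"
    and "\<And>x y. x \<in> F \<Longrightarrow> y \<in> F \<Longrightarrow> x + y \<in> F" "\<And>x y. x \<in> F \<Longrightarrow> y \<in> F \<Longrightarrow> x * y \<in> F"
  shows "subfield F complex_ring"
  by (intro field.subfieldI'[OF field_complex_ring] complex_ring.subringI) (auto simp: complex_ring_m_inv assms)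

lemma subfield_complexD:
  assumes "subfield F complex_ring"
  shows "0 \<in> F" "1 \<in> F" "x \<in> F \<Longrightarrow> - x \<in> F" "x \<in> F \<Longrightarrow> inverse x \<in> F"
    "x \<in> F \<Longrightarrow> y \<in> F \<Longrightarrow> x + y \<in> F" "x \<in> F \<Longrightarrow> y \<in> F \<Longrightarrow> x - y \<in> F"
    "x \<in> F \<Longrightarrow> y \<in> F \<Longrightarrow> x * y \<in> F"
proof -
  have sub: "subring F complex_ring"
    by (rule subfieldE(1)[OF assms])
  note D = subringE[OF sub, simplified]
  show zero: "0 \<in> F" and "1 \<in> F" "x \<in> F \<Longrightarrow> - x \<in> F"
    and add: "x \<in> F \<Longrightarrow> y \<in> F \<Longrightarrow> x + y \<in> F" and "x \<in> F \<Longrightarrow> y \<in> F \<Longrightarrow> x * y \<in> F"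
    using D by auto
  show "x \<in> F \<Longrightarrow> y \<in> F \<Longrightarrow> x - y \<in> F"
    using D(5)[of y] D(7)[of x "- y"] by simp
  show "x \<in> F \<Longrightarrow> inverse x \<in> F"
    using zero complex_ring.subfield_m_inv(1)[OF assms, of x] by (cases "x = 0") (auto simp: complex_ring_m_inv)
qed

lemma subfield_Rats: "subfield (\<rat> :: complex set) complex_ring"
  by (rule subfield_complexI) auto

text \<open>Inverses come from the conjugate \<open>u - v * b\<close>, whose product with
  \<open>u + v * b\<close> lies in \<open>F\<close>. The element \<open>b\<close> may itself lie in
  \<open>F\<close>.\<close>

lemma subfield_adjoin_root:
  fixes F :: "complex set"
  assumes F: "subfield F complex_ring" and b: "b * b \<in> F"
  shows "subfield {u + v * b | u v. u \<in> F \<and> v \<in> F} complex_ring" (is "subfield ?G _")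
proof (rule subfield_complexI)
  note cl = subfield_complexD[OF F]
  have I: "u + v * b \<in> ?G" if "u \<in> F" "v \<in> F" for u v
    using that by auto
  have emb: "u \<in> ?G" if "u \<in> F" for u
    using I[OF that cl(1)] by simp
  show "1 \<in> ?G" using emb[OF cl(2)] .
  show "- x \<in> ?G" if x: "x \<in> ?G" for x
  proof -
    obtain u v where "u \<in> F" "v \<in> F" "x = u + v * b" using x by auto
    then show ?thesis using I[of "- u" "- v"] cl by (simp add: algebra_simps)
  qed
  show "x + y \<in> ?G" if xy: "x \<in> ?G" "y \<in> ?G" for x y
  proof -
    obtain u v u' v' where "u \<in> F" "v \<in> F" "x = u + v * b" "u' \<in> F" "v' \<in> F" "y = u' + v' * b"
      using xy by auto
    then show ?thesis using I[of "u + u'" "v + v'"] cl by (simp add: algebra_simps)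
  qed
  show mult: "x * y \<in> ?G" if xy: "x \<in> ?G" "y \<in> ?G" for x y
  proof -
    obtain u v u' v' where *: "u \<in> F" "v \<in> F" "x = u + v * b" "u' \<in> F" "v' \<in> F" "y = u' + v' * b"
      using xy by auto
    have "u * u' + v * v' * (b * b) \<in> F" "u * v' + u' * v \<in> F"
      using * b cl by auto
    from I[OF this] * show ?thesis by (simp add: algebra_simps)
  qed
  show "inverse x \<in> ?G" if x: "x \<in> ?G" for x
  proof -
    obtain u v where uv: "u \<in> F" "v \<in> F" "x = u + v * b" using x by auto
    define x' where "x' = u - v * b"
    have x': "x' \<in> ?G" using I[of u "- v"] uv cl by (simp add: x'_def)
    have xx': "x * x' = u * u - v * v * (b * b)" by (simp add: uv x'_def algebra_simps)
    show ?thesis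
    proof (cases "x' = 0")
      \<comment> \<open>Now \<open>u = v * b\<close>, so \<open>x\<close> is twice \<open>u\<close>.
        With \<open>b\<close> in \<open>F\<close> this can happen for nonzero
        \<open>x\<close>.\<close>
      case True
      then have "x = u + u" by (simp add: uv x'_def)
      with cl(5)[OF uv(1) uv(1)] have "x \<in> F" by metis
      then show ?thesis by (intro emb cl)
    next
      case False
      show ?thesis
      proof (cases "x = 0")
        case True
        then show ?thesis using emb[OF cl(1)] by simp
      next
        case x0: False
        have "x * x' \<in> F" unfolding xx' using uv b cl by auto
        then have "x' * inverse (x * x') \<in> ?G"
          by (intro mult[OF x']) (rule emb, rule cl(4))
        also have "x' * inverse (x * x') = inverse x" using False by (simp add: field_simps)
        finally show ?thesis .
      qed
    qed
  qed
qed

text \<open>Adjoining the two roots one after the other gives a field with exactly these elements.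
  It contains both generators, so it contains the generated field; the converse inclusion is closure
  under the field operations.\<close>

lemma Q_adjoin_sqrts_eq:
  defines "a \<equiv> \<lambda>n. complex_of_real (sqrt (real n))"
  shows "Q_adjoin_sqrts p q =
    {w + x * a p + y * a q + z * (a p * a q) | w x y z. w \<in> \<rat> \<and> x \<in> \<rat> \<and> y \<in> \<rat> \<and> z \<in> \<rat>}"
    (is "_ = ?R")
    and "subfield (Q_adjoin_sqrts p q) complex_ring"
proof -
  have sq: "a n * a n = of_nat n" for n
    by (simp add: a_def flip: of_real_mult)
  define F where "F = {u + v * a p | u v. u \<in> \<rat> \<and> v \<in> \<rat>}"
  have F: "subfield F complex_ring"
    unfolding F_def by (rule subfield_adjoin_root[OF subfield_Rats]) (simp add: sq)
  have "of_nat q \<in> F"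
    unfolding F_def by (intro CollectI exI[of _ "of_nat q"] exI[of _ 0]) auto
  then have G: "subfield {u + v * a q | u v. u \<in> F \<and> v \<in> F} complex_ring" (is "subfield ?G _")
    by (intro subfield_adjoin_root[OF F]) (simp add: sq)
  have "?G = ?R"
  proof (intro equalityI subsetI)
    fix t assume "t \<in> ?G"
    then obtain w x y z where *: "w \<in> \<rat>" "x \<in> \<rat>" "y \<in> \<rat>" "z \<in> \<rat>"
      and t: "t = (w + x * a p) + (y + z * a p) * a q" by (auto simp: F_def)
    from t have "t = w + x * a p + y * a q + z * (a p * a q)" by (simp add: algebra_simps)
    with * show "t \<in> ?R" by blast
  next
    fix t assume "t \<in> ?R"
    then obtain w x y z where *: "w \<in> \<rat>" "x \<in> \<rat>" "y \<in> \<rat>" "z \<in> \<rat>"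
      and t: "t = w + x * a p + y * a q + z * (a p * a q)" by blast
    from t have "t = (w + x * a p) + (y + z * a p) * a q" by (simp add: algebra_simps)
    moreover have "w + x * a p \<in> F" "y + z * a p \<in> F" using * by (auto simp: F_def)
    ultimately show "t \<in> ?G" by blast
  qed
  with G have R: "subfield ?R complex_ring" by simp
  have QK: "Q_adjoin_sqrts p q = generate_field complex_ring {a p, a q}"
    by (simp add: Q_adjoin_sqrts_def a_def)
  have K: "subfield (generate_field complex_ring {a p, a q}) complex_ring"
    by (rule field.generate_field_is_subfield[OF field_complex_ring]) simp
  then show "subfield (Q_adjoin_sqrts p q) complex_ring" by (simp add: QK)
  note cl = subfield_complexD[OF K]
  have "a p = 0 + 1 * a p + 0 * a q + 0 * (a p * a q)" "a q = 0 + 0 * a p + 1 * a q + 0 * (a p * a q)"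
    by simp_all
  then have gens: "{a p, a q} \<subseteq> ?R"
    using Rats_0 Rats_1 by blast
  show "Q_adjoin_sqrts p q = ?R"
    unfolding QK
  proof
    show "generate_field complex_ring {a p, a q} \<subseteq> ?R"
      by (rule field.generate_field_min_subfield1[OF field_complex_ring _ R gens]) simp
  next
    have aK: "a p \<in> generate_field complex_ring {a p, a q}" "a q \<in> generate_field complex_ring {a p, a q}"
      by (auto intro: generate_field.incl)
    have nat: "of_nat n \<in> generate_field complex_ring {a p, a q}" for n
      by (induction n) (auto intro: cl)
    have int: "of_int n \<in> generate_field complex_ring {a p, a q}" for n
      by (cases n rule: int_cases2) (auto intro: cl nat)
    have "x \<in> generate_field complex_ring {a p, a q}" if "x \<in> \<rat>" for x
      using that by (elim Rats_cases') (auto simp: divide_inverse intro!: cl int)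
    then show "?R \<subseteq> generate_field complex_ring {a p, a q}"
      using aK by (auto intro!: cl(5,7))
  qed
qed

text \<open>Discarding each vector that lies in the span of the later ones leaves a basis of the
  same span. If anything were discarded, this basis would be shorter than the dimension.\<close>

lemma (in ring) independent_if_dimension_Span:
  assumes K: "subfield K R" and "set Us \<subseteq> carrier R" and dim: "dimension (length Us) K (Span K Us)"
  shows "independent K Us"
proof -
  have "\<exists>Vs. independent K Vs \<and> Span K Vs = Span K Us \<and> length Vs \<le> length Us \<and>
          (independent K Us \<or> length Vs < length Us)"
    using assms(2)
  proof (induction Us)
    case Nil
    then show ?case by auto
  next
    case (Cons u Us)
    then obtain Vs where Vs: "independent K Vs" "Span K Vs = Span K Us" "length Vs \<le> length Us"
      "independent K Us \<or> length Vs < length Us" by auto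
    show ?case
    proof (cases "u \<in> Span K Us")
      case True
      then have "Span K (u # Us) = Span K Us"
        using Span_base_incl[OF K] mono_Span_subset[OF K] Cons.prems
        by (metis insert_subset list.simps(15) subset_antisym)
      with Vs show ?thesis by (intro exI[of _ Vs]) simp
    next
      case False
      with Vs Cons.prems show ?thesis
        by (intro exI[of _ "u # Vs"]) (auto intro: li_Cons)
    qed
  qed
  then obtain Vs where Vs: "independent K Vs" "Span K Vs = Span K Us"
      "independent K Us \<or> length Vs < length Us" by blast
  have "length Vs = length Us"
    using dimension_is_inj[OF K] dimension_independent[OF Vs(1)] Vs(2) dim by metis
  with Vs(3) show ?thesis by simp
qed

text \<open>The degree enters here: four elements that span a space of dimension 4 are linearly
  independent.\<close>

lemma Q_adjoin_sqrts_independent: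
  defines "a \<equiv> \<lambda>n. complex_of_real (sqrt (real n))"
  assumes dim: "ring.dimension complex_ring 4 \<rat> (Q_adjoin_sqrts p q)"
    and rat: "w \<in> \<rat>" "x \<in> \<rat>" "y \<in> \<rat>" "z \<in> \<rat>"
    and zero: "w + x * a p + y * a q + z * (a p * a q) = 0"
  shows "w = 0 \<and> x = 0 \<and> y = 0 \<and> z = 0"
proof -
  have Q_eq: "Q_adjoin_sqrts p q =
    {w + x * a p + y * a q + z * (a p * a q) | w x y z. w \<in> \<rat> \<and> x \<in> \<rat> \<and> y \<in> \<rat> \<and> z \<in> \<rat>}"
    unfolding a_def by (rule Q_adjoin_sqrts_eq(1))
  define Us where "Us = [1, a p, a q, a p * a q]"
  have len: "length Us = 4" by (simp add: Us_def)
  have comb: "complex_ring.combine [w, x, y, z] Us = w + x * a p + y * a q + z * (a p * a q)" for w x y z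
    by (simp add: Us_def)
  have "complex_ring.Span \<rat> Us = {complex_ring.combine Ks Us | Ks. length Ks = length Us \<and> set Ks \<subseteq> \<rat>}"
    by (rule complex_ring.Span_eq_combine_set_length_version[OF subfield_Rats]) simp
  also have "\<dots> = Q_adjoin_sqrts p q"
    unfolding Q_eq
  proof (intro equalityI subsetI)
    fix t assume "t \<in> {complex_ring.combine Ks Us | Ks. length Ks = length Us \<and> set Ks \<subseteq> \<rat>}"
    then obtain Ks where Ks: "t = complex_ring.combine Ks Us" "length Ks = 4" "set Ks \<subseteq> \<rat>"
      by (auto simp: Us_def)
    then obtain w x y z where "Ks = [w, x, y, z]"
      by (auto simp: numeral_eq_Suc length_Suc_conv)
    with Ks comb show "t \<in> {w + x * a p + y * a q + z * (a p * a q) | w x y z. w \<in> \<rat> \<and> x \<in> \<rat> \<and> y \<in> \<rat> \<and> z \<in> \<rat>}"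
      by auto
  next
    fix t assume "t \<in> {w + x * a p + y * a q + z * (a p * a q) | w x y z. w \<in> \<rat> \<and> x \<in> \<rat> \<and> y \<in> \<rat> \<and> z \<in> \<rat>}"
    then obtain w x y z where "w \<in> \<rat>" "x \<in> \<rat>" "y \<in> \<rat>" "z \<in> \<rat>" "t = complex_ring.combine [w, x, y, z] Us"
      unfolding comb by blast
    then show "t \<in> {complex_ring.combine Ks Us | Ks. length Ks = length Us \<and> set Ks \<subseteq> \<rat>}"
      by (intro CollectI exI[of _ "[w, x, y, z]"]) (auto simp: Us_def)
  qed
  finally have "complex_ring.dimension (length Us) \<rat> (complex_ring.Span \<rat> Us)"
    using dim by (simp only: len)
  then have ind: "complex_ring.independent \<rat> Us"
    by (intro complex_ring.independent_if_dimension_Span[OF subfield_Rats]) auto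
  have "set (take (length Us) [w, x, y, z]) \<subseteq> {\<zero>\<^bsub>complex_ring\<^esub>}"
    using rat zero complex_ring.independent_imp_trivial_combine[OF subfield_Rats ind, of "[w, x, y, z]"]
    by (simp only: comb) simp
  then show ?thesis by (simp add: Us_def)
qed

text \<open>The trace is \<open>2 * u\<close>. Integrality makes \<open>2 * v\<close> an integer,
  nonzero since the conjugates differ, and positivity of both conjugates makes \<open>2 * u\<close>
  exceed the absolute value of \<open>2 * v * sqrt d\<close>.\<close>

lemma trace_gt_sqrt:
  fixes \<delta> \<delta>' u v :: complex
  assumes d: "squarefree d" and uv: "u \<in> \<rat>" "v \<in> \<rat>"
    and \<delta>: "\<delta> = u + v * of_real (sqrt (real d))" "\<delta>' = u - v * of_real (sqrt (real d))"
    and int: "algebraic_int \<delta>" "algebraic_int \<delta>'"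
    and pos: "0 < \<delta>" "0 < \<delta>'"
    and neq: "\<delta> \<noteq> \<delta>'"
  shows "sqrt (real d) < Re (\<delta> + \<delta>')"
proof -
  obtain u' v' where uv': "u = of_real u'" "v = of_real v'"
  proof -
    have "x \<in> \<real>" if "x \<in> \<rat>" for x :: complex
      using that by (auto elim!: Rats_cases')
    then show ?thesis using uv that by (metis Reals_cases)
  qed
  have "2 * v \<in> \<rat>" using uv by auto
  then obtain m n where mn: "n > 0" "coprime m n" "2 * v = of_int m / of_int n"
    by (elim Rats_cases')
  \<comment> \<open>The difference of the conjugates is \<open>2 * v * sqrt d\<close>; its square is
    rational as well as integral, hence an integer.\<close>
  have "algebraic_int ((\<delta> + - \<delta>') * (\<delta> + - \<delta>'))"
    using int by (intro algebraic_int_mult algebraic_int_add algebraic_int_minus)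
  also have "(\<delta> + - \<delta>') * (\<delta> + - \<delta>') = (2 * v) * (2 * v) * (of_real (sqrt (real d)) * of_real (sqrt (real d)))"
    by (simp add: \<delta>)
  also have "\<dots> = (2 * v) * (2 * v) * of_nat d"
    by (simp flip: of_real_mult)
  finally have "algebraic_int ((2 * v) * (2 * v) * of_nat d)" .
  moreover have "(2 * v) * (2 * v) * of_nat d \<in> \<rat>" using uv by auto
  ultimately have "(2 * v) * (2 * v) * of_nat d \<in> \<int>"
    by (rule rational_algebraic_int_is_int)
  then obtain k where k: "(2 * v) * (2 * v) * of_nat d = of_int k" by (auto elim: Ints_cases)
  have "of_int (k * (n * n)) = (2 * v * of_int n) * (2 * v * of_int n) * of_nat d"
    by (simp only: of_int_mult k[symmetric] mult_ac)
  also have "2 * v * of_int n = of_int m" using mn by simp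
  finally have "of_int (m * m * int d) = (of_int (k * (n * n)) :: complex)" by simp
  then have "m * m * int d = k * (n * n)"
    by (simp only: of_int_eq_iff)
  \<comment> \<open>As \<open>m / n\<close> is in lowest terms, the square of \<open>n\<close> must
    divide the squarefree \<open>d\<close>, which forces the denominator of \<open>2 * v\<close> to
    be 1.\<close>
  then have "n * n dvd (m * m) * int d" by simp
  moreover have "coprime (n * n) (m * m)" using mn(2) by (simp add: coprime_commute)
  ultimately have "n * n dvd int d" by (simp add: coprime_dvd_mult_right_iff)
  moreover obtain n' where n': "n = int n'" using mn(1) by (metis zero_less_imp_eq_int)
  ultimately have "n' ^ 2 dvd d" by (simp add: power2_eq_square flip: of_nat_mult)
  then have "n = 1" using d n' by (auto simp: squarefree_def)
  have v0: "v \<noteq> 0" and d0: "d > 0" using neq d by (auto simp: \<delta> intro!: Nat.gr0I)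
  from mn(3) \<open>n = 1\<close> have "complex_of_real (2 * v') = of_real (of_int m)" by (simp add: uv')
  then have v'm: "2 * v' = of_int m" by (simp only: of_real_eq_iff)
  with v0 have "m \<noteq> 0" by (auto simp: uv')
  then have "\<bar>2 * v'\<bar> \<ge> 1" unfolding v'm by linarith
  then have "sqrt (real d) * 1 \<le> sqrt (real d) * \<bar>2 * v'\<bar>"
    by (intro mult_left_mono) auto
  then have "sqrt (real d) \<le> \<bar>2 * (v' * sqrt (real d))\<bar>"
    by (simp add: abs_mult mult_ac)
  \<comment> \<open>Positivity of \<open>u' + v' * sqrt d\<close> and of
    \<open>u' - v' * sqrt d\<close> bounds the absolute value of \<open>v' * sqrt d\<close> by
    \<open>u'\<close>.\<close>
  also have "\<dots> < 2 * u'"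
    using pos by (auto simp: \<delta> uv' less_complex_def abs_if)
  finally show ?thesis by (simp add: \<delta> uv')
qed

section \<open>Coordinates, Galois group and norm of the biquadratic field\<close>

locale biquadratic_field =
  fixes p q :: nat and K :: "complex set" and a b :: complex
  defines "a \<equiv> complex_of_real (sqrt (real p))" and "b \<equiv> complex_of_real (sqrt (real q))"
  assumes squarefree: "squarefree p" "squarefree q"
    and K_eq: "K = Q_adjoin_sqrts p q"
    and dim: "ring.dimension complex_ring 4 \<rat> K"
begin

lemma a_sq: "a * a = of_nat p" and b_sq: "b * b = of_nat q"
  by (simp_all add: a_def b_def flip: of_real_mult)

text \<open>Coordinates with respect to the basis 1, \<open>a\<close>, \<open>b\<close>,
  \<open>a * b\<close>. Taking \<open>a * b\<close> instead of the square root of \<open>r\<close>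
  keeps the multiplication table polynomial in \<open>p\<close> and \<open>q\<close>.\<close>

definition elt :: "complex \<Rightarrow> complex \<Rightarrow> complex \<Rightarrow> complex \<Rightarrow> complex" where
  "elt w x y z = w + x * a + y * b + z * (a * b)"

lemma elt_in_K: "w \<in> \<rat> \<Longrightarrow> x \<in> \<rat> \<Longrightarrow> y \<in> \<rat> \<Longrightarrow> z \<in> \<rat> \<Longrightarrow> elt w x y z \<in> K"
  unfolding K_eq Q_adjoin_sqrts_eq(1) elt_def a_def b_def by blast

lemma K_cases [consumes 1]:
  assumes "u \<in> K"
  obtains w x y z where "w \<in> \<rat>" "x \<in> \<rat>" "y \<in> \<rat>" "z \<in> \<rat>" "u = elt w x y z"
  using assms unfolding K_eq Q_adjoin_sqrts_eq(1) elt_def a_def b_def by blast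

lemma subfield_K: "subfield K complex_ring"
  unfolding K_eq by (rule Q_adjoin_sqrts_eq(2))

lemmas K_closed = subfield_complexD[OF subfield_K]

lemma a_in_K: "a \<in> K" and b_in_K: "b \<in> K"
  using elt_in_K[of 0 1 0 0] elt_in_K[of 0 0 1 0] by (simp_all add: elt_def)

lemma Rats_subset_K: "\<rat> \<subseteq> K"
  using elt_in_K[of _ 0 0 0] by (auto simp: elt_def)

lemma elt_eq_iff:
  assumes "w \<in> \<rat>" "x \<in> \<rat>" "y \<in> \<rat>" "z \<in> \<rat>" "w' \<in> \<rat>" "x' \<in> \<rat>" "y' \<in> \<rat>" "z' \<in> \<rat>"
  shows "elt w x y z = elt w' x' y' z' \<longleftrightarrow> w = w' \<and> x = x' \<and> y = y' \<and> z = z'"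
proof
  assume "elt w x y z = elt w' x' y' z'"
  then have "(w - w') + (x - x') * a + (y - y') * b + (z - z') * (a * b) = 0"
    by (simp add: elt_def algebra_simps)
  then have "w - w' = 0 \<and> x - x' = 0 \<and> y - y' = 0 \<and> z - z' = 0"
    using Q_adjoin_sqrts_independent[of p q "w - w'" "x - x'" "y - y'" "z - z'"] dim assms
    by (simp add: a_def b_def K_eq)
  then show "w = w' \<and> x = x' \<and> y = y' \<and> z = z'" by simp
qed auto

lemma a_nonzero: "a \<noteq> 0" and b_nonzero: "b \<noteq> 0"
  using elt_eq_iff[of 0 1 0 0 0 0 0 0] elt_eq_iff[of 0 0 1 0 0 0 0 0] by (auto simp: elt_def)

lemma elt_add: "elt w x y z + elt w' x' y' z' = elt (w + w') (x + x') (y + y') (z + z')"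
  by (simp add: elt_def algebra_simps)

lemma elt_mult:
  "elt w x y z * elt w' x' y' z' =
     elt (w * w' + of_nat p * (x * x') + of_nat q * (y * y') + of_nat p * of_nat q * (z * z'))
       (w * x' + x * w' + of_nat q * (y * z' + z * y'))
       (w * y' + y * w' + of_nat p * (x * z' + z * x'))
       (w * z' + z * w' + x * y' + y * x')"
  unfolding elt_def a_sq[symmetric] b_sq[symmetric] by (simp add: algebra_simps)

text \<open>For signs \<open>s\<close> and \<open>t\<close> these are the four elements of the
  Galois group, given by \<open>a\<close> to \<open>s * a\<close> and \<open>b\<close> to
  \<open>t * b\<close>. The description is unique because coordinates are, and the restriction to
  \<open>K\<close> matches the extensional maps in \<open>embeddings\<close>.\<close>

definition galois :: "complex \<Rightarrow> complex \<Rightarrow> complex \<Rightarrow> complex" where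
  "galois s t = restrict (\<lambda>u. THE v. \<exists>w\<in>\<rat>. \<exists>x\<in>\<rat>. \<exists>y\<in>\<rat>. \<exists>z\<in>\<rat>.
     u = elt w x y z \<and> v = elt w (s * x) (t * y) (s * t * z)) K"

lemma galois_elt:
  assumes "w \<in> \<rat>" "x \<in> \<rat>" "y \<in> \<rat>" "z \<in> \<rat>"
  shows "galois s t (elt w x y z) = elt w (s * x) (t * y) (s * t * z)"
proof -
  have "(THE v. \<exists>w'\<in>\<rat>. \<exists>x'\<in>\<rat>. \<exists>y'\<in>\<rat>. \<exists>z'\<in>\<rat>.
     elt w x y z = elt w' x' y' z' \<and> v = elt w' (s * x') (t * y') (s * t * z')) =
     elt w (s * x) (t * y) (s * t * z)"
    using assms by (intro the_equality) (auto simp: elt_eq_iff)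
  then show ?thesis
    using elt_in_K[OF assms] by (simp add: galois_def)
qed

abbreviation signs :: "complex set" where "signs \<equiv> {1, -1}"

lemma galois_in_K:
  assumes "s \<in> signs" "t \<in> signs" "u \<in> K"
  shows "galois s t u \<in> K"
  using assms(3)
proof (cases rule: K_cases)
  case (1 w x y z)
  then show ?thesis using assms(1,2) by (auto simp: galois_elt intro!: elt_in_K)
qed

lemma galois_Rats:
  assumes "u \<in> \<rat>"
  shows "galois s t u = u"
  using galois_elt[of u 0 0 0 s t] assms by (simp add: elt_def)

lemma galois_a: "galois s t a = s * a" and galois_b: "galois s t b = t * b"
  using galois_elt[of 0 1 0 0 s t] galois_elt[of 0 0 1 0 s t] by (simp_all add: elt_def)

lemma galois_add:
  assumes "u \<in> K" "v \<in> K"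
  shows "galois s t (u + v) = galois s t u + galois s t v"
  using assms(1)
proof (cases rule: K_cases)
  case u: (1 w x y z)
  from assms(2) show ?thesis
  proof (cases rule: K_cases)
    case (1 w' x' y' z')
    with u show ?thesis by (simp add: elt_add galois_elt algebra_simps)
  qed
qed

text \<open>Multiplicativity rests on \<open>s * s = 1\<close> and \<open>t * t = 1\<close>, which
  preserve the relations \<open>a * a = p\<close> and \<open>b * b = q\<close>.\<close>

lemma galois_mult:
  assumes "s \<in> signs" "t \<in> signs" "u \<in> K" "v \<in> K"
  shows "galois s t (u * v) = galois s t u * galois s t v"
  using assms(3)
proof (cases rule: K_cases)
  case u: (1 w x y z)
  from assms(4) show ?thesis
  proof (cases rule: K_cases)
    case v: (1 w' x' y' z')
    have "s = 1 \<or> s = -1" "t = 1 \<or> t = -1" using assms(1,2) by auto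
    then show ?thesis
      by (elim disjE) (simp_all add: u v elt_mult galois_elt algebra_simps)
  qed
qed

lemma galois_galois:
  assumes "s \<in> signs" "t \<in> signs" "s' \<in> signs" "t' \<in> signs" "u \<in> K"
  shows "galois s t (galois s' t' u) = galois (s * s') (t * t') u"
  using assms(5)
proof (cases rule: K_cases)
  case (1 w x y z)
  then show ?thesis using assms(1-4) by (auto simp: galois_elt)
qed

lemma galois_id: "u \<in> K \<Longrightarrow> galois 1 1 u = u"
  by (erule K_cases) (simp add: galois_elt)

text \<open>An automorphism fixes integer coefficients, so it sends roots of an integer polynomial
  to roots of the same polynomial.\<close>

lemma algebraic_int_galois:
  assumes "s \<in> signs" "t \<in> signs" "u \<in> K" "algebraic_int u"
  shows "algebraic_int (galois s t u)"
proof -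
  obtain P where P: "poly (map_poly of_int P) u = 0" "lead_coeff P = 1"
    using assms(4) by (auto simp: algebraic_int_altdef_ipoly)
  \<comment> \<open>Membership in \<open>K\<close> is carried through the induction because
    \<open>galois\<close> respects sums and products only there.\<close>
  have "poly (map_poly of_int Q) u \<in> K \<and>
      galois s t (poly (map_poly of_int Q) u) = poly (map_poly of_int Q) (galois s t u)" for Q :: "int poly"
  proof (induction Q)
    case 0
    then show ?case by (simp add: K_closed galois_Rats)
  next
    case (pCons c Q)
    have c: "of_int c \<in> K" using Rats_subset_K by auto
    show ?case
      using pCons.IH c assms
      by (simp add: of_int_hom.map_poly_pCons_hom K_closed galois_add galois_mult galois_Rats)
  qed
  from this[of P] P show ?thesis
    by (auto simp: algebraic_int_altdef_ipoly galois_Rats)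
qed

lemma galois_in_embeddings:
  assumes "s \<in> signs" "t \<in> signs"
  shows "galois s t \<in> embeddings K"
  unfolding embeddings_def
proof
  show "galois s t \<in> Ring.ring_hom (subring_of_complex K) complex_ring"
    using assms by (intro ring_hom_memI) (simp_all add: galois_add galois_mult galois_Rats)
  show "galois s t \<in> extensional K" by (simp add: galois_def)
qed

text \<open>An embedding fixes the rationals and is therefore determined by the images of
  \<open>a\<close> and \<open>b\<close>.\<close>

lemma embeddings_eq: "embeddings K = (\<lambda>(s, t). galois s t) ` (signs \<times> signs)"
proof (intro equalityI subsetI)
  fix \<sigma> assume \<sigma>: "\<sigma> \<in> embeddings K"
  then have "\<sigma> \<in> Ring.ring_hom (subring_of_complex K) complex_ring" by (simp add: embeddings_def)
  note hom = ring_hom_memE[OF this, simplified]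
  have add: "\<sigma> (x + y) = \<sigma> x + \<sigma> y" and mult: "\<sigma> (x * y) = \<sigma> x * \<sigma> y"
    if "x \<in> K" "y \<in> K" for x y
    using hom(2,3)[OF that] by auto
  have one: "\<sigma> 1 = 1" using hom(4) by simp
  have inK: "of_int k \<in> K" "of_nat n \<in> K" for k n using Rats_subset_K by auto
  have zero: "\<sigma> 0 = 0" using add[of 0 0] K_closed(1) by simp
  have nat: "\<sigma> (of_nat n) = of_nat n" for n
    by (induction n) (simp_all add: zero one add K_closed inK)
  have int: "\<sigma> (of_int k) = of_int k" for k
  proof (cases k rule: int_cases2)
    case (nonneg n)
    then show ?thesis by (simp add: nat)
  next
    case (nonpos n)
    have "\<sigma> (of_int k + of_nat n) = \<sigma> (of_int k) + of_nat n"
      by (simp only: add inK nat)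
    with nonpos zero show ?thesis by (simp add: add_eq_0_iff2)
  qed
  have rat: "\<sigma> x = x" if x: "x \<in> \<rat>" for x
  proof -
    obtain m n where mn: "n > 0" "x = of_int m / of_int n" using x by (elim Rats_cases')
    have "\<sigma> (x * of_int n) = \<sigma> x * of_int n"
      using x Rats_subset_K by (subst mult) (auto simp: int)
    with mn int[of m] show ?thesis by (simp add: field_simps)
  qed
  \<comment> \<open>The images of \<open>a\<close> and \<open>b\<close> are again square roots of
    \<open>p\<close> and \<open>q\<close>, so only their signs are free.\<close>
  have "\<sigma> a * \<sigma> a = a * a" "\<sigma> b * \<sigma> b = b * b"
    using mult[OF a_in_K a_in_K] mult[OF b_in_K b_in_K] by (simp_all add: a_sq b_sq nat)
  then have "\<sigma> a = a \<or> \<sigma> a = - a" "\<sigma> b = b \<or> \<sigma> b = - b"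
    by (simp_all add: square_eq_iff)
  then obtain s t where st: "s \<in> signs" "t \<in> signs" "\<sigma> a = s * a" "\<sigma> b = t * b"
    by force
  have "\<sigma> = galois s t"
  proof (rule extensionalityI)
    show "\<sigma> \<in> extensional K" using \<sigma> by (simp add: embeddings_def)
    show "galois s t \<in> extensional K" by (simp add: galois_def)
    fix u assume "u \<in> K"
    then show "\<sigma> u = galois s t u"
    proof (cases rule: K_cases)
      case (1 w x y z)
      have K: "w \<in> K" "x \<in> K" "y \<in> K" "z \<in> K" using 1 Rats_subset_K by auto
      have "\<sigma> u = \<sigma> w + \<sigma> x * \<sigma> a + \<sigma> y * \<sigma> b + \<sigma> z * (\<sigma> a * \<sigma> b)"
        unfolding 1(5) elt_def using K a_in_K b_in_K by (simp add: add mult K_closed)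
      also have "\<dots> = galois s t u"
        unfolding 1(5) galois_elt[OF 1(1-4)] using 1 by (simp add: rat st elt_def mult_ac)
      finally show ?thesis .
    qed
  qed
  with st show "\<sigma> \<in> (\<lambda>(s, t). galois s t) ` (signs \<times> signs)" by auto
qed (auto intro!: galois_in_embeddings)

lemma field_norm_eq:
  assumes "u \<in> K"
  shows "field_norm K u = u * galois 1 (-1) u * galois (-1) 1 u * galois (-1) (-1) u"
proof -
  \<comment> \<open>The norm is a product over a set of maps, so the four sign pairs must give four
    different maps; their values at \<open>a\<close> and \<open>b\<close> tell them apart.\<close>
  have "inj_on (\<lambda>(s, t). galois s t) (signs \<times> signs)"
  proof (rule inj_onI, clarify)
    fix s t s' t' assume "galois s t = galois s' t'"
    then have "s * a = s' * a" "t * b = t' * b" by (metis galois_a, metis galois_b)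
    then show "s = s' \<and> t = t'" using a_nonzero b_nonzero by simp
  qed
  then have "field_norm K u = (\<Prod>(s, t)\<in>signs \<times> signs. galois s t u)"
    unfolding field_norm_def embeddings_eq by (subst prod.reindex) (auto simp: case_prod_beta)
  also have "\<dots> = (\<Prod>s\<in>signs. \<Prod>t\<in>signs. galois s t u)"
    by (rule prod.cartesian_product[symmetric])
  also have "\<dots> = u * galois 1 (-1) u * galois (-1) 1 u * galois (-1) (-1) u"
    using galois_id[OF assms] by simp
  finally show ?thesis .
qed

lemma totally_positive_integers_iff:
  "u \<in> totally_positive_integers K \<longleftrightarrow>
     u \<in> K \<and> algebraic_int u \<and> (\<forall>s\<in>signs. \<forall>t\<in>signs. 0 < galois s t u)"
  unfolding totally_positive_integers_def ring_of_integers_def embeddings_eq by auto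

end

section \<open>Decompositions of elements of small norm\<close>

text \<open>Dividing \<open>p\<close> and \<open>q\<close> by their gcd leaves coprime squarefree
  cofactors, and the quotient is the product of these.\<close>

lemma squarefree_mult_div_gcd_square:
  fixes p q :: nat
  assumes "squarefree p" "squarefree q"
  shows "squarefree (p * q div (gcd p q)\<^sup>2)" "p * q = (gcd p q)\<^sup>2 * (p * q div (gcd p q)\<^sup>2)"
proof -
  have pq: "p \<noteq> 0" "q \<noteq> 0" using assms not_squarefree_0 by metis+
  obtain p' q' where g: "p = p' * gcd p q" "q = q' * gcd p q" "coprime p' q'"
    using gcd_coprime_exists[of p q] pq by auto
  have eq: "p * q = (gcd p q)\<^sup>2 * (p' * q')"
    by (subst g(1), subst g(2)) (simp add: power2_eq_square mult_ac)
  then have r: "p * q div (gcd p q)\<^sup>2 = p' * q'" using pq by simp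
  then show "p * q = (gcd p q)\<^sup>2 * (p * q div (gcd p q)\<^sup>2)" using eq by simp
  have "squarefree p'" "squarefree q'"
    using assms g(1,2) by (metis squarefree_multD(1))+
  then show "squarefree (p * q div (gcd p q)\<^sup>2)"
    unfolding r using g(3) by (simp add: squarefree_mult_coprime)
qed

text \<open>Put \<open>xi = bi / gi\<close>. The hypotheses say \<open>x0 * x1 = x2 * x3\<close> and
  \<open>x0 * x2 = x1 * x3\<close>. Multiplying them gives equal squares of \<open>x0\<close> and
  \<open>x3\<close>, so positivity yields \<open>x0 = x3\<close>, and then
  \<open>x1 = x2\<close>.\<close>

lemma ratio_eq_if_two_products_eq:
  fixes b0 b1 b2 b3 g0 g1 g2 g3 :: real
  assumes pos: "b0 > 0" "b1 > 0" "b2 > 0" "b3 > 0" "g0 > 0" "g1 > 0" "g2 > 0" "g3 > 0"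
    and 1: "b0 * b1 * g2 * g3 = b2 * b3 * g0 * g1"
    and 2: "b0 * b2 * g1 * g3 = b1 * b3 * g0 * g2"
  shows "b0 * g3 = b3 * g0 \<and> b1 * g2 = b2 * g1"
proof -
  have "(b0 * g3)\<^sup>2 * (b1 * b2 * g1 * g2) = (b0 * b1 * g2 * g3) * (b0 * b2 * g1 * g3)"
    by (simp add: power2_eq_square mult_ac)
  also have "\<dots> = (b3 * g0)\<^sup>2 * (b1 * b2 * g1 * g2)"
    unfolding 1 2 by (simp add: power2_eq_square mult_ac)
  finally have "(b0 * g3)\<^sup>2 = (b3 * g0)\<^sup>2" using pos by simp
  then have *: "b0 * g3 = b3 * g0" using pos by simp
  have "(b3 * g0) * (b1 * g2) = b0 * b1 * g2 * g3"
    unfolding *[symmetric] by (simp add: mult_ac)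
  also have "\<dots> = (b3 * g0) * (b2 * g1)"
    unfolding 1 by (simp add: mult_ac)
  finally have "(b3 * g0) * (b1 * g2) = (b3 * g0) * (b2 * g1)" .
  then have "b1 * g2 = b2 * g1" using pos by simp
  with * show ?thesis ..
qed

text \<open>The real-number core of the argument. The index numbers the conjugates,
  \<open>d1\<close>, \<open>d2\<close>, \<open>d3\<close> stand for the square roots of
  \<open>p\<close>, \<open>q\<close>, \<open>r\<close>, and the \<open>ei\<close> are the conjugates
  of the element \<epsilon>. The disjunctions are trace dichotomies: conjugates agree or their sum
  is large.\<close>

lemma conjugate_products_eq:
  fixes b0 b1 b2 b3 g0 g1 g2 g3 :: real
  defines "e0 \<equiv> b0 * g1 * g2 * g3" and "e1 \<equiv> b1 * g0 * g2 * g3"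
    and "e2 \<equiv> b2 * g0 * g1 * g3" and "e3 \<equiv> b3 * g0 * g1 * g2"
  assumes pos: "b0 > 0" "b1 > 0" "b2 > 0" "b3 > 0" "g0 > 0" "g1 > 0" "g2 > 0" "g3 > 0"
    and N: "(b0 + g0) * (b1 + g1) * (b2 + g2) * (b3 + g3) < 2 * min d1 (min d2 d3)"
    and D1: "b0 * b1 * g2 * g3 = b2 * b3 * g0 * g1 \<or> d1 < b0 * b1 * g2 * g3 + b2 * b3 * g0 * g1"
    and D2: "b0 * b2 * g1 * g3 = b1 * b3 * g0 * g2 \<or> d2 < b0 * b2 * g1 * g3 + b1 * b3 * g0 * g2"
    and D3: "b0 * b3 * g1 * g2 = b1 * b2 * g0 * g3 \<or> d3 < b0 * b3 * g1 * g2 + b1 * b2 * g0 * g3"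
    and E1: "e0 = e1 \<Longrightarrow> e0 = e2 \<or> d1 < e0 + e2"
    and E2: "e0 = e2 \<Longrightarrow> e0 = e1 \<or> d2 < e0 + e1"
    and E3: "e0 = e3 \<Longrightarrow> e0 = e1 \<or> d3 < e0 + e1"
  shows "e0 = e1 \<and> e0 = e2 \<and> e0 = e3"
proof -
  define m where "m = min d1 (min d2 d3)"
  have m: "m \<le> d1" "m \<le> d2" "m \<le> d3" by (simp_all add: m_def)
  define P1 P2 P3 where "P1 = b0 * b1 * g2 * g3 + b2 * b3 * g0 * g1"
    and "P2 = b0 * b2 * g1 * g3 + b1 * b3 * g0 * g2"
    and "P3 = b0 * b3 * g1 * g2 + b1 * b2 * g0 * g3"
  \<comment> \<open>The sixteen terms of the product are the six in \<open>P1\<close>,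
    \<open>P2\<close>, \<open>P3\<close>, the four \<open>ei\<close> and the six in
    \<open>R\<close>.\<close>
  define R where "R = b0 * b1 * b2 * b3 + g0 * g1 * g2 * g3 +
    (b0 * b1 * b2 * g3 + b0 * b1 * b3 * g2 + b0 * b2 * b3 * g1 + b1 * b2 * b3 * g0)"
  have "(b0 + g0) * (b1 + g1) * (b2 + g2) * (b3 + g3) = P1 + P2 + P3 + (e0 + e1 + e2 + e3) + R"
    by (simp add: P1_def P2_def P3_def R_def e0_def e1_def e2_def e3_def algebra_simps)
  moreover have "R > 0" "P1 > 0" "P2 > 0" "P3 > 0" "e0 > 0" "e1 > 0" "e2 > 0" "e3 > 0"
    using pos by (auto simp: P1_def P2_def P3_def R_def e0_def e1_def e2_def e3_def
        intro!: add_pos_pos mult_pos_pos)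
  \<comment> \<open>Two of the \<open>Pi\<close> cannot both reach \<open>m\<close>, so at most one
    of them exceeds its \<open>di\<close>.\<close>
  ultimately have bound: "P1 + P2 < 2 * m" "P1 + P3 < 2 * m" "P2 + P3 < 2 * m"
      "e0 + e1 + e2 + e3 < 2 * m"
    using N unfolding m_def[symmetric] by linarith+
  show ?thesis
  proof (cases "d1 < P1")
    case True
    then have "\<not> d2 < P2" "\<not> d3 < P3" using bound m by linarith+
    \<comment> \<open>The factors are arranged so that the ratio lemma applies with the indices 1
      and 3 exchanged.\<close>
    then have "b0 * b2 * g3 * g1 = b3 * b1 * g0 * g2" "b0 * b3 * g2 * g1 = b2 * b1 * g0 * g3"
      using D2 D3 by (simp_all add: P2_def P3_def mult_ac)
    from ratio_eq_if_two_products_eq[OF _ _ _ _ _ _ _ _ this(2,1)] pos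
    have r: "b0 * g1 = b1 * g0" "b3 * g2 = b2 * g3" by auto
    then have "e0 = e1" "e2 = e3" by (simp_all add: e0_def e1_def e2_def e3_def mult_ac)
    \<comment> \<open>Since the \<open>ei\<close> agree in pairs, \<open>e0 + e2\<close> is half of
      their total and hence below \<open>m\<close>.\<close>
    moreover from this have "\<not> d1 < e0 + e2" using bound(4) m by linarith
    ultimately show ?thesis using E1 by simp
  next
    case F1: False
    then have D1': "b0 * b1 * g2 * g3 = b2 * b3 * g0 * g1" using D1 by (simp add: P1_def)
    show ?thesis
    proof (cases "d2 < P2")
      case True
      then have "\<not> d3 < P3" using bound m by linarith
      then have "b0 * b3 * g1 * g2 = b1 * b2 * g0 * g3" using D3 by (simp add: P3_def)
      \<comment> \<open>Here the indices 2 and 3 are exchanged.\<close>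
      with D1' have "b0 * b1 * g3 * g2 = b3 * b2 * g0 * g1" "b0 * b3 * g1 * g2 = b1 * b2 * g0 * g3"
        by (simp_all add: mult_ac)
      from ratio_eq_if_two_products_eq[OF _ _ _ _ _ _ _ _ this] pos
      have r: "b0 * g2 = b2 * g0" "b1 * g3 = b3 * g1" by auto
      then have "e0 = e2" "e1 = e3" by (simp_all add: e0_def e1_def e2_def e3_def mult_ac)
      moreover from this have "\<not> d2 < e0 + e1" using bound(4) m by linarith
      ultimately show ?thesis using E2 by simp
    next
      case False
      \<comment> \<open>Two equalities suffice: this case covers both a large \<open>P3\<close> and
        no large \<open>Pi\<close> at all.\<close>
      then have "b0 * b2 * g1 * g3 = b1 * b3 * g0 * g2" using D2 by (simp add: P2_def)
      from ratio_eq_if_two_products_eq[OF _ _ _ _ _ _ _ _ D1' this] pos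
      have r: "b0 * g3 = b3 * g0" "b1 * g2 = b2 * g1" by auto
      then have "e0 = e3" "e1 = e2" by (simp_all add: e0_def e1_def e2_def e3_def mult_ac)
      moreover from this have "\<not> d3 < e0 + e1" using bound(4) m by linarith
      ultimately show ?thesis using E3 by simp
    qed
  qed
qed

lemma eq_uminus_zero: "(x::complex) = - x \<Longrightarrow> x = 0"
  by (simp add: complex_eq_iff)

section \<open>Traces of totally positive integers and divisibility of sums\<close>

context biquadratic_field
begin

abbreviation T :: "complex set" where "T \<equiv> totally_positive_integers K"

lemma totally_positive_integersD: "u \<in> T \<Longrightarrow> u \<in> K" "u \<in> T \<Longrightarrow> algebraic_int u" "u \<in> T \<Longrightarrow> 0 < u"
  using galois_id by (force simp: totally_positive_integers_iff)+

lemma totally_positive_galois: "u \<in> T \<Longrightarrow> s \<in> signs \<Longrightarrow> t \<in> signs \<Longrightarrow> galois s t u \<in> T"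
  unfolding totally_positive_integers_iff
  by (intro conjI ballI) (auto intro!: galois_in_K algebraic_int_galois simp: galois_galois)

lemma totally_positive_mult: "u \<in> T \<Longrightarrow> v \<in> T \<Longrightarrow> u * v \<in> T"
  unfolding totally_positive_integers_iff
  by (intro conjI ballI) (auto intro!: K_closed mult_pos_pos simp: galois_mult less_complex_def)

lemma trace_galois_gt:
  assumes u: "u \<in> T" "u = x + y * of_real (sqrt (real d))" "x \<in> \<rat>" "y \<in> \<rat>"
    and d: "squarefree d" "s \<in> signs" "t \<in> signs" "galois s t u = x - y * of_real (sqrt (real d))"
  shows "u = galois s t u \<or> sqrt (real d) < Re (u + galois s t u)"
proof -
  have "galois s t u \<in> T" using u d by (intro totally_positive_galois)
  with trace_gt_sqrt[OF d(1) u(3,4,2) d(4) totally_positive_integersD(2)[OF u(1)]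
      totally_positive_integersD(2) totally_positive_integersD(3)[OF u(1)] totally_positive_integersD(3)]
  show ?thesis
    by blast
qed

text \<open>The fixed field of \<open>galois 1 (-1)\<close> is generated by \<open>a\<close>. On it
  both choices of \<open>t\<close> give the same nontrivial conjugation.\<close>

lemma trace_gt_sqrt_p:
  assumes u: "u \<in> T" "galois 1 (-1) u = u" and t: "t \<in> signs"
  shows "u = galois (-1) t u \<or> sqrt (real p) < Re (u + galois (-1) t u)"
proof (rule K_cases[OF totally_positive_integersD(1)[OF u(1)]])
  fix w x y z assume *: "w \<in> \<rat>" "x \<in> \<rat>" "y \<in> \<rat>" "z \<in> \<rat>" "u = elt w x y z"
  from u(2) * have yz: "y = 0" "z = 0"
    by (auto simp: galois_elt elt_eq_iff dest: eq_uminus_zero sym)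
  have "galois (-1) t u = elt w (- x) 0 0"
    unfolding *(5) galois_elt[OF *(1-4)] by (simp add: yz)
  then show ?thesis
    using * u t squarefree yz by (intro trace_galois_gt[of u w x]) (auto simp: elt_def a_def)
qed

lemma trace_gt_sqrt_q:
  assumes u: "u \<in> T" "galois (-1) 1 u = u" and s: "s \<in> signs"
  shows "u = galois s (-1) u \<or> sqrt (real q) < Re (u + galois s (-1) u)"
proof (rule K_cases[OF totally_positive_integersD(1)[OF u(1)]])
  fix w x y z assume *: "w \<in> \<rat>" "x \<in> \<rat>" "y \<in> \<rat>" "z \<in> \<rat>" "u = elt w x y z"
  from u(2) * have xz: "x = 0" "z = 0"
    by (auto simp: galois_elt elt_eq_iff dest: eq_uminus_zero sym)
  have "galois s (-1) u = elt w 0 (- y) 0"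
    unfolding *(5) galois_elt[OF *(1-4)] by (simp add: xz)
  then show ?thesis
    using * u s squarefree xz by (intro trace_galois_gt[of u w y]) (auto simp: elt_def b_def)
qed

text \<open>The fixed field of \<open>galois (-1) (-1)\<close> is generated by \<open>a * b\<close>,
  which is \<open>gcd p q\<close> times the square root of \<open>r\<close>. The automorphisms with
  signs \<open>s\<close> and \<open>-s\<close> are those that negate it.\<close>

lemma trace_gt_sqrt_r:
  assumes u: "u \<in> T" "galois (-1) (-1) u = u" and s: "s \<in> signs"
    and r: "r = p * q div (gcd p q)\<^sup>2"
  shows "u = galois s (-s) u \<or> sqrt (real r) < Re (u + galois s (-s) u)"
proof (rule K_cases[OF totally_positive_integersD(1)[OF u(1)]])
  fix w x y z assume *: "w \<in> \<rat>" "x \<in> \<rat>" "y \<in> \<rat>" "z \<in> \<rat>" "u = elt w x y z"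
  from u(2) * have xy: "x = 0" "y = 0"
    by (auto simp: galois_elt elt_eq_iff dest: eq_uminus_zero sym)
  define g where "g = gcd p q"
  note sf = squarefree_mult_div_gcd_square[OF squarefree, folded r g_def]
  have "sqrt (real p) * sqrt (real q) = sqrt (real (g\<^sup>2 * r))"
    by (simp flip: real_sqrt_mult of_nat_mult sf(2))
  also have "\<dots> = real g * sqrt (real r)" by (simp add: real_sqrt_mult)
  finally have "complex_of_real (sqrt (real p) * sqrt (real q)) = of_real (real g * sqrt (real r))"
    by (rule arg_cong)
  then have ab: "a * b = of_nat g * of_real (sqrt (real r))"
    by (simp add: a_def b_def)
  have ss: "s * s = 1" using s by auto
  have "galois s (-s) u = elt w 0 0 (- z)"
    unfolding *(5) galois_elt[OF *(1-4)] using ss by (simp add: xy)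
  then show ?thesis
    using * u s sf(1) xy by (intro trace_galois_gt[of u w "z * of_nat g"]) (auto simp: elt_def ab)
qed

lemma fixed_in_Rats:
  assumes u: "u \<in> K" "galois 1 (-1) u = u" "galois (-1) 1 u = u"
  shows "u \<in> \<rat>"
proof (rule K_cases[OF u(1)])
  fix w x y z assume *: "w \<in> \<rat>" "x \<in> \<rat>" "y \<in> \<rat>" "z \<in> \<rat>" "u = elt w x y z"
  from u * have "x = 0" "y = 0" "z = 0"
    by (auto simp: galois_elt elt_eq_iff dest: eq_uminus_zero sym)
  with * show ?thesis by (simp add: elt_def)
qed

lemma fixed_is_nat:
  assumes u: "u \<in> T" "galois 1 (-1) u = u" "galois (-1) 1 u = u"
  obtains n where "n > 0" "u = of_nat n"
proof -
  have "u \<in> \<int>"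
    using fixed_in_Rats[OF totally_positive_integersD(1)[OF u(1)] u(2,3)] totally_positive_integersD(2)[OF u(1)] by (intro rational_algebraic_int_is_int)
  then obtain k where k: "u = of_int k" by (elim Ints_cases)
  with totally_positive_integersD(3)[OF u(1)] have "k > 0" by (simp add: less_complex_def)
  with k show ?thesis by (intro that[of "nat k"]) auto
qed

text \<open>With \<alpha> = \<beta> + \<gamma> the relation becomes
  \<open>m * \<alpha> = (m + n) * \<gamma>\<close>. If \<open>u / v\<close> is
  \<open>m / (m + n)\<close> in lowest terms, then \<open>v\<close> divides \<alpha>, and
  \<open>v > 1\<close> because \<open>0 < u < v\<close>.\<close>

lemma sum_divisible_if_proportional:
  assumes T: "\<beta> \<in> T" "\<gamma> \<in> T" and mn: "m > 0" "n > 0" "of_nat m * \<beta> = of_nat n * \<gamma>"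
  obtains k c where "k > 1" "c \<in> ring_of_integers K" "\<beta> + \<gamma> = of_nat k * c"
proof -
  define \<alpha> where "\<alpha> = \<beta> + \<gamma>"
  obtain u v where uv: "m = u * gcd m (m + n)" "m + n = v * gcd m (m + n)" "coprime u v"
    using gcd_coprime_exists[of m "m + n"] mn by auto
  define g where "g = gcd m (m + n)"
  have g: "g > 0" using mn by (simp add: g_def)
  have "u < v" using uv(1,2) mn(2) g unfolding g_def by (metis less_add_same_cancel1 mult_less_cancel2)
  moreover have "u > 0" using uv(1) mn(1) by (metis gr0I mult_0)
  ultimately have v: "v > 1" by linarith
  have "of_nat m * \<alpha> = of_nat (m + n) * \<gamma>"
    using mn(3) by (simp add: \<alpha>_def algebra_simps)
  then have "of_nat g * (of_nat u * \<alpha>) = of_nat g * (of_nat v * \<gamma>)"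
    by (subst (asm) uv(1), subst (asm) uv(2)) (simp add: g_def mult_ac)
  then have eq: "of_nat u * \<alpha> = of_nat v * \<gamma>" using g by simp
  obtain x y where xy: "x * int u + y * int v = 1"
    using uv(3) by (metis bezout_int coprime_int_iff coprime_imp_gcd_eq_1)
  \<comment> \<open>The quotient of \<alpha> by \<open>v\<close>, written through the Bezout
    coefficients so that its integrality is visible.\<close>
  define c where "c = of_int x * \<gamma> + of_int y * \<alpha>"
  have int: "algebraic_int (of_int k :: complex)" for k by (rule int_imp_algebraic_int) auto
  have "of_int k \<in> K" for k using Rats_subset_K by auto
  then have "c \<in> ring_of_integers K"
    unfolding ring_of_integers_def c_def \<alpha>_def using totally_positive_integersD[OF T(1)] totally_positive_integersD[OF T(2)] int
    by (auto intro!: K_closed)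
  moreover have "\<alpha> = of_nat v * c"
  proof -
    have "of_nat v * c = of_int x * (of_nat v * \<gamma>) + of_int (y * int v) * \<alpha>"
      by (simp add: c_def algebra_simps)
    also have "\<dots> = of_int (x * int u + y * int v) * \<alpha>"
      unfolding eq[symmetric] by (simp add: algebra_simps)
    finally show ?thesis by (simp add: xy)
  qed
  ultimately show ?thesis using v that by (simp add: \<alpha>_def)
qed

text \<open>The small norm forces all conjugates of \<open>E\<close>, the element \<epsilon> =
  \<beta>N(\<gamma>)/\<gamma>, to coincide. So \<open>E\<close> is a positive integer, as is the
  norm of \<gamma>, and \<beta> and \<gamma> are proportional over the positive integers.\<close>

lemma sum_divisible_if_small_norm:
  assumes T: "\<beta> \<in> T" "\<gamma> \<in> T" and r: "r = p * q div (gcd p q)\<^sup>2"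
    and N: "field_norm K (\<beta> + \<gamma>) <
      complex_of_real (2 * min (sqrt (real p)) (min (sqrt (real q)) (sqrt (real r))))"
  obtains k c where "k > 1" "c \<in> ring_of_integers K" "\<beta> + \<gamma> = of_nat k * c"
proof -
  \<comment> \<open>The three nontrivial automorphisms; their fixed fields are generated by the
    square roots of \<open>p\<close>, \<open>q\<close> and \<open>r\<close> respectively.\<close>
  define t1 t2 t3 where "t1 = galois 1 (-1)" and "t2 = galois (-1) 1" and "t3 = galois (-1) (-1)"
  note t_defs = t1_def t2_def t3_def
  have mult: "t1 (u * v) = t1 u * t1 v" "t2 (u * v) = t2 u * t2 v" "t3 (u * v) = t3 u * t3 v"
    if "u \<in> K" "v \<in> K" for u v
    using that by (simp_all add: t_defs galois_mult)
  have add: "t1 (u + v) = t1 u + t1 v" "t2 (u + v) = t2 u + t2 v" "t3 (u + v) = t3 u + t3 v"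
    if "u \<in> K" "v \<in> K" for u v
    using that by (simp_all add: t_defs galois_add)
  have comp: "t1 (t1 u) = u" "t2 (t2 u) = u" "t3 (t3 u) = u" "t1 (t2 u) = t3 u" "t2 (t1 u) = t3 u"
    "t1 (t3 u) = t2 u" "t3 (t1 u) = t2 u" "t2 (t3 u) = t1 u" "t3 (t2 u) = t1 u"
    if "u \<in> K" for u
    using that by (simp_all add: t_defs galois_galois galois_id)
  have tT: "t1 u \<in> T" "t2 u \<in> T" "t3 u \<in> T" if "u \<in> T" for u
    using that by (auto simp: t_defs intro!: totally_positive_galois)
  have K: "u \<in> K" "t1 u \<in> K" "t2 u \<in> K" "t3 u \<in> K" if "u \<in> T" for u
    using that tT totally_positive_integersD(1) by auto
  note Tsimps = mult comp tT totally_positive_mult K T K_closed(7)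
  have tr1: "u = t2 u \<or> sqrt (real p) < Re (u + t2 u)" if "u \<in> T" "t1 u = u" for u
    using trace_gt_sqrt_p[of u 1] that by (simp add: t_defs)
  have tr2: "u = t1 u \<or> sqrt (real q) < Re (u + t1 u)" if "u \<in> T" "t2 u = u" for u
    using trace_gt_sqrt_q[of u 1] that by (simp add: t_defs)
  have tr3: "u = t1 u \<or> sqrt (real r) < Re (u + t1 u)" if "u \<in> T" "t3 u = u" for u
    using trace_gt_sqrt_r[of u 1, OF _ _ _ r] that by (simp add: t_defs)

  \<comment> \<open>\<open>D\<^sub>i\<close> is \<open>N\<^bsub>K/L\<^esub>(\<beta>)\<close> times the conjugate of \<open>N\<^bsub>K/L\<^esub>(\<gamma>)\<close>, where \<open>L\<close> is the fixed
    field of \<open>t\<^sub>i\<close>.\<close>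
  define D1 D2 D3 E where "D1 = \<beta> * t1 \<beta> * (t2 \<gamma> * t3 \<gamma>)" and "D2 = \<beta> * t2 \<beta> * (t1 \<gamma> * t3 \<gamma>)"
    and "D3 = \<beta> * t3 \<beta> * (t1 \<gamma> * t2 \<gamma>)" and "E = \<beta> * (t1 \<gamma> * t2 \<gamma> * t3 \<gamma>)"
  have DT: "D1 \<in> T" "D2 \<in> T" "D3 \<in> T" "E \<in> T"
    by (simp_all add: D1_def D2_def D3_def E_def Tsimps)
  have D_fixed: "t1 D1 = D1" "t2 D2 = D2" "t3 D3 = D3"
    by (simp_all add: D1_def D2_def D3_def Tsimps)
  \<comment> \<open>On the fixed field of one \<open>ti\<close> the other two automorphisms agree,
    so either of them gives the conjugate.\<close>
  have D_conj: "t2 D1 = t2 \<beta> * t3 \<beta> * (\<gamma> * t1 \<gamma>)" "t1 D2 = t1 \<beta> * t3 \<beta> * (t2 \<gamma> * \<gamma>)"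
      "t1 D3 = t1 \<beta> * t2 \<beta> * (\<gamma> * t3 \<gamma>)"
    by (simp_all add: D1_def D2_def D3_def Tsimps mult_ac)
  have E_conj: "t1 E = t1 \<beta> * (\<gamma> * t3 \<gamma> * t2 \<gamma>)" "t2 E = t2 \<beta> * (t3 \<gamma> * \<gamma> * t1 \<gamma>)"
      "t3 E = t3 \<beta> * (t2 \<gamma> * t1 \<gamma> * \<gamma>)"
    by (simp_all add: E_def Tsimps)

  define b0 b1 b2 b3 where "b0 = Re \<beta>" and "b1 = Re (t1 \<beta>)" and "b2 = Re (t2 \<beta>)" and "b3 = Re (t3 \<beta>)"
  define g0 g1 g2 g3 where "g0 = Re \<gamma>" and "g1 = Re (t1 \<gamma>)" and "g2 = Re (t2 \<gamma>)" and "g3 = Re (t3 \<gamma>)"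
  note bg_defs = b0_def b1_def b2_def b3_def g0_def g1_def g2_def g3_def
  have real: "u = of_real (Re u)" "Re u > 0" if "u \<in> T" for u
    using totally_positive_integersD(3)[OF that] by (auto simp: less_complex_def complex_eq_iff)
  have pos: "b0 > 0" "b1 > 0" "b2 > 0" "b3 > 0" "g0 > 0" "g1 > 0" "g2 > 0" "g3 > 0"
    unfolding bg_defs using T tT by (blast intro: real(2))+
  have b: "\<beta> = of_real b0" "t1 \<beta> = of_real b1" "t2 \<beta> = of_real b2" "t3 \<beta> = of_real b3"
    and g: "\<gamma> = of_real g0" "t1 \<gamma> = of_real g1" "t2 \<gamma> = of_real g2" "t3 \<gamma> = of_real g3"
    unfolding bg_defs using T tT by (blast intro: real(1))+
  define e0 e1 e2 e3 where "e0 = b0 * g1 * g2 * g3" and "e1 = b1 * g0 * g2 * g3"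
    and "e2 = b2 * g0 * g1 * g3" and "e3 = b3 * g0 * g1 * g2"
  note e_defs = e0_def e1_def e2_def e3_def
  have D: "D1 = of_real (b0 * b1 * g2 * g3)" "t2 D1 = of_real (b2 * b3 * g0 * g1)"
    "D2 = of_real (b0 * b2 * g1 * g3)" "t1 D2 = of_real (b1 * b3 * g0 * g2)"
    "D3 = of_real (b0 * b3 * g1 * g2)" "t1 D3 = of_real (b1 * b2 * g0 * g3)"
    \<comment> \<open>The equations for the nontrivial conjugates come first: rewriting \<beta> and
      \<gamma> themselves would also change the arguments inside \<open>t1 \<beta>\<close> and its
      companions.\<close>
    unfolding D_conj unfolding D1_def D2_def D3_def b(2-4) g(2-4) unfolding b(1) g(1) by (simp_all add: mult_ac)
  have E: "E = of_real e0" "t1 E = of_real e1" "t2 E = of_real e2" "t3 E = of_real e3"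
    unfolding E_conj unfolding E_def e_defs b(2-4) g(2-4) unfolding b(1) g(1) by (simp_all add: mult_ac)

  have "field_norm K (\<beta> + \<gamma>) = of_real ((b0 + g0) * (b1 + g1) * (b2 + g2) * (b3 + g3))"
  proof -
    have "\<beta> + \<gamma> \<in> K" using T K(1) by (simp add: K_closed)
    then have "field_norm K (\<beta> + \<gamma>) = (\<beta> + \<gamma>) * t1 (\<beta> + \<gamma>) * t2 (\<beta> + \<gamma>) * t3 (\<beta> + \<gamma>)"
      by (simp add: field_norm_eq t_defs)
    also have "\<dots> = (\<beta> + \<gamma>) * (t1 \<beta> + t1 \<gamma>) * (t2 \<beta> + t2 \<gamma>) * (t3 \<beta> + t3 \<gamma>)"
      using T K(1) by (simp add: add)
    finally show ?thesis unfolding b(2-4) g(2-4) unfolding b(1) g(1) by simp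
  qed
  with N have N': "(b0 + g0) * (b1 + g1) * (b2 + g2) * (b3 + g3) <
      2 * min (sqrt (real p)) (min (sqrt (real q)) (sqrt (real r)))"
    by (simp only: less_complex_def Re_complex_of_real)
  have "e0 = e1 \<and> e0 = e2 \<and> e0 = e3"
  proof (rule conjugate_products_eq[OF pos N', folded e_defs])
    show "b0 * b1 * g2 * g3 = b2 * b3 * g0 * g1 \<or>
        sqrt (real p) < b0 * b1 * g2 * g3 + b2 * b3 * g0 * g1"
      using tr1[OF DT(1) D_fixed(1)] unfolding D(2,4,6) unfolding D(1,3,5) by (simp only: of_real_eq_iff plus_complex.sel Re_complex_of_real)
    show "b0 * b2 * g1 * g3 = b1 * b3 * g0 * g2 \<or>
        sqrt (real q) < b0 * b2 * g1 * g3 + b1 * b3 * g0 * g2"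
      using tr2[OF DT(2) D_fixed(2)] unfolding D(2,4,6) unfolding D(1,3,5) by (simp only: of_real_eq_iff plus_complex.sel Re_complex_of_real)
    show "b0 * b3 * g1 * g2 = b1 * b2 * g0 * g3 \<or>
        sqrt (real r) < b0 * b3 * g1 * g2 + b1 * b2 * g0 * g3"
      using tr3[OF DT(3) D_fixed(3)] unfolding D(2,4,6) unfolding D(1,3,5) by (simp only: of_real_eq_iff plus_complex.sel Re_complex_of_real)
    show "e0 = e2 \<or> sqrt (real p) < e0 + e2" if "e0 = e1"
      using tr1[OF DT(4)] that unfolding E(2-4) unfolding E(1) by simp
    show "e0 = e1 \<or> sqrt (real q) < e0 + e1" if "e0 = e2"
      using tr2[OF DT(4)] that unfolding E(2-4) unfolding E(1) by simp
    show "e0 = e1 \<or> sqrt (real r) < e0 + e1" if "e0 = e3"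
      using tr3[OF DT(4)] that unfolding E(2-4) unfolding E(1) by simp
  qed
  \<comment> \<open>The automorphisms \<open>t1\<close> and \<open>t2\<close> generate the Galois
    group, so \<open>E\<close> is rational.\<close>
  then have "t1 E = E" "t2 E = E" by (metis E)+
  then obtain n where n: "n > 0" "E = of_nat n"
    using fixed_is_nat[OF DT(4)] by (auto simp: t_defs)
  \<comment> \<open>The norm of \<gamma>, chosen because
    \<open>M * \<beta> = E * \<gamma>\<close>.\<close>
  define M where "M = \<gamma> * (t1 \<gamma> * t2 \<gamma> * t3 \<gamma>)"
  have "M \<in> T" "t1 M = M" "t2 M = M" by (simp_all add: M_def Tsimps mult_ac)
  then obtain m where m: "m > 0" "M = of_nat m"
    using fixed_is_nat[of M] by (auto simp: t_defs)
  have "of_nat m * \<beta> = of_nat n * \<gamma>"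
    unfolding n(2)[symmetric] m(2)[symmetric] by (simp add: M_def E_def mult_ac)
  then show ?thesis using sum_divisible_if_proportional[OF T m(1) n(1)] that by blast
qed

end

theorem proposition3p3:
  fixes p q r :: nat and K :: "complex set" and \<alpha> :: complex
  assumes "squarefree p" and "p > 0" and "squarefree q" and "q > 0"
    and "K = Q_adjoin_sqrts p q"
    and "ring.dimension complex_ring 4 \<rat> K"
    and "r = p * q div (gcd p q)\<^sup>2"
    and "\<alpha> \<in> totally_positive_integers K"
    and "field_norm K \<alpha> <
           complex_of_real (2 * min (sqrt (real p)) (min (sqrt (real q)) (sqrt (real r))))"
    and "\<And>n::nat. n > 1 \<Longrightarrow>
           \<not> of_nat n divides\<^bsub>subring_of_complex (ring_of_integers K)\<^esub> \<alpha>"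
  shows "indecomposable K \<alpha>"
  unfolding indecomposable_def
proof (intro conjI notI)
  interpret biquadratic_field p q K "complex_of_real (sqrt (real p))" "complex_of_real (sqrt (real q))"
    using assms by unfold_locales
  assume "\<exists>y\<in>totally_positive_integers K. \<exists>z\<in>totally_positive_integers K. \<alpha> = y + z"
  then obtain \<beta> \<gamma> where \<beta>\<gamma>: "\<beta> \<in> totally_positive_integers K" "\<gamma> \<in> totally_positive_integers K" "\<alpha> = \<beta> + \<gamma>" by auto
  obtain n c where "n > 1" "c \<in> ring_of_integers K" "\<alpha> = of_nat n * c"
    using sum_divisible_if_small_norm[OF \<beta>\<gamma>(1,2) assms(7)] assms(9) unfolding \<beta>\<gamma>(3) by blast
  \<comment> \<open>Divisibility in the ring of integers asks for a cofactor in that ring, which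
    \<open>c\<close> is.\<close>
  then have "of_nat n divides\<^bsub>subring_of_complex (ring_of_integers K)\<^esub> \<alpha>"
    by (auto simp: factor_def)
  with assms(10)[OF \<open>n > 1\<close>] show False by contradiction
qed (rule assms(8))

end
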